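(* Let $\mathcal{X}$ be a set of $n\times n$ matrices over $\mathbb{R}_{\max}$ satisfying the standing assumptions (A1)–(A3) listed in the context, let $A_1,\dots,A_k\in\mathcal{X}$, and let $\Gamma(k)=A_1\otimes A_2\otimes\cdots\otimes A_k$. Suppose that $$k>\max_{i,j\in\{1,\dots,n\}}\max\left(\frac{w_i+v_j-\gamma_{ij}}{\lambda^*}+(n-1),\ \frac{w_i-\alpha_i+v_j-\beta_j}{\lambda^*}+2(n-1)\right).$$ Then $\Gamma(k)$ is rank-one (a max-plus outer product of a column vector and a row vector), and $$\Gamma(k)=\begin{bmatrix}\Gamma(k)_{1,1}\\ \Gamma(k)_{2,1}\\ \vdots\\ \Gamma(k)_{n,1}\end{bmatrix}\otimes\begin{bmatrix}\Gamma(k)_{1,1}&\Gamma(k)_{1,2}&\cdots&\Gamma(k)_{1,n}\end{bmatrix}.$$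
   Context: Max-plus algebra: $\mathbb{R}_{\max}=\mathbb{R}\cup\{-\infty\}$, $a\oplus b=\max\{a,b\}$, $a\otimes b=a+b$; for matrices, $(A\otimes B)_{i,j}=\max_{k}(a_{i,k}+b_{k,j})$; in particular $(\vec{x}\otimes\vec{y}^{\top})_{i,j}=x_i+y_j$ for column vectors $\vec x,\vec y$. Digraphs: for $A\in\mathbb{R}_{\max}^{n\times n}$, $\mathcal{D}_A$ is the weighted digraph with nodes $N=\{1,\dots,n\}$, edge set $E_A=\{(i,j): a_{i,j}\neq-\infty\}$, and edge weights $a_{i,j}$. A walk is a sequence of nodes $(i_0,\dots,i_l)$ with consecutive pairs being edges; its length is $l$ and its weight is the sum of the weights of its edges; $(i_0)$ is a walk of length $0$ and weight $0$. A path is a walk with no repeated nodes; a cycle is a walk with $i_0=i_l$. $A$ is irreducible if $\mathcal{D}_A$ is strongly connected. $A,B$ are geometrically equivalent if $E_A=E_B$. A critical cycle of $\mathcal{D}_A$ is an elementary cycle (no repeated node except start = end, length at least 1) whose mean weight (weight divided by length) is maximal among all cycles of $\mathcal{D}_A$. Matrix set: $\mathcal{X}$ is a nonempty (possibly infinite) set of matrices in $\mathbb{R}_{\max}^{n\times n}$; $A^{\sup}$ and $A^{\inf}$ are the entrywise supremum and infimum over $\mathcal{X}$. Standing assumptions: (A1) the matrices in $\mathcal{X}$ are irreducible and pairwise geometrically equivalent, and $A^{\inf}$ is geometrically equivalent to them; (A2) for each $X\in\mathcal{X}$, $\mathcal{D}_X$ has a unique critical cycle, namely the loop of length $1$ at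 node $1$, with weight $0$; (A3) $\mathcal{D}_{A^{\sup}}$ has a unique critical cycle, namely the loop of length $1$ at node $1$, with weight $0$. Parameters (maxima over empty sets are $-\infty$): $\lambda^*$ is the largest cycle mean in the submatrix $(A^{\sup}_{i,j})_{i,j\neq1}$, i.e. $\lambda^*=\max_{r\ge1}\max_{2\le i_1,\dots,i_r\le n}\frac{A^{\sup}_{i_1i_2}+\dots+A^{\sup}_{i_ri_1}}{r}$; $\alpha_i$ is the maximal weight of paths on $\mathcal{D}_{A^{\sup}}$ connecting $i$ to $1$; $\beta_j$ is the maximal weight of paths on $\mathcal{D}_{A^{\sup}}$ connecting $1$ to $j$; $\gamma_{ij}$ is the maximal weight of paths on $\mathcal{D}_{A^{\sup}}$ connecting $i$ to $j$ and not going through node $1$; $w_i$ is the maximal weight of walks of length not exceeding $k$ on $\mathcal{D}_{A^{\inf}}$ connecting $i$ to $1$; $v_j$ is the maximal weight of walks of length not exceeding $k$ on $\mathcal{D}_{A^{\inf}}$ connecting $1$ to $j$. Conventions for degenerate values: if $\gamma_{ij}=-\infty$, the quotient containing $\gamma_{ij}$ is $-\infty$ (imposes no condition); otherwise, if $\lambda^*=-\infty$, quotients by $\lambda^*$ are $0$; otherwise a numerator equal to $-\infty$ gives a quotient $+\infty$ (since $\lambda^*<0$). *)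

theory Defs
  imports "HOL-Analysis.Finite_Cartesian_Product" "HOL-Library.Extended_Real"
begin

text \<open>
  The max-plus semiring is represented by the extended reals different from \<open>\<infinity>\<close>.
  The index type \<open>'n\<close> plays the role of the node set \<open>{1, \<dots>, n}\<close> with \<open>n = CARD('n)\<close>,
  and the parameter \<open>c :: 'n\<close> below is the distinguished node \<open>1\<close>.
\<close>

definition over_rmax :: "ereal ^ 'n ^ 'n \<Rightarrow> bool" where
  "over_rmax A \<longleftrightarrow> (\<forall>i j. A $ i $ j \<noteq> \<infinity>)"

definition mp_mult :: "ereal ^ 'n ^ 'n \<Rightarrow> ereal ^ 'n ^ 'n \<Rightarrow> ereal ^ 'n ^ 'n"
    (infixl \<open>\<otimes>\<close> 70) where
  "A \<otimes> B = (\<chi> i j. MAX k. A $ i $ k + B $ k $ j)"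

definition mp_one :: "ereal ^ 'n ^ 'n" where
  "mp_one = (\<chi> i j. if i = j then 0 else -\<infinity>)"

primrec mp_prod :: "(nat \<Rightarrow> ereal ^ 'n ^ 'n) \<Rightarrow> nat \<Rightarrow> ereal ^ 'n ^ 'n" where
  "mp_prod A 0 = mp_one"
| "mp_prod A (Suc k) = mp_prod A k \<otimes> A (Suc k)"

definition mp_outer :: "ereal ^ 'n \<Rightarrow> ereal ^ 'n \<Rightarrow> ereal ^ 'n ^ 'n" where
  "mp_outer x y = (\<chi> i j. x $ i + y $ j)"

definition rank_one :: "ereal ^ 'n ^ 'n \<Rightarrow> bool" where
  "rank_one A \<longleftrightarrow>
     (\<exists>x y. (\<forall>i. x $ i \<noteq> \<infinity>) \<and> (\<forall>j. y $ j \<noteq> \<infinity>) \<and> A = mp_outer x y)"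

definition edges :: "ereal ^ 'n ^ 'n \<Rightarrow> ('n \<times> 'n) set" where
  "edges A = {(i, j). A $ i $ j \<noteq> -\<infinity>}"

definition geom_equiv :: "ereal ^ 'n ^ 'n \<Rightarrow> ereal ^ 'n ^ 'n \<Rightarrow> bool" where
  "geom_equiv A B \<longleftrightarrow> edges A = edges B"

definition is_walk :: "ereal ^ 'n ^ 'n \<Rightarrow> 'n list \<Rightarrow> bool" where
  "is_walk A p \<longleftrightarrow> p \<noteq> [] \<and> successively (\<lambda>i j. (i, j) \<in> edges A) p"

definition walk_length :: "'n list \<Rightarrow> nat" where
  "walk_length p = length p - 1"

definition walk_weight :: "ereal ^ 'n ^ 'n \<Rightarrow> 'n list \<Rightarrow> ereal" where
  "walk_weight A p = (\<Sum>(i, j) \<leftarrow> zip p (tl p). A $ i $ j)"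

definition walk_from_to :: "ereal ^ 'n ^ 'n \<Rightarrow> 'n \<Rightarrow> 'n \<Rightarrow> 'n list \<Rightarrow> bool" where
  "walk_from_to A i j p \<longleftrightarrow> is_walk A p \<and> hd p = i \<and> last p = j"

definition path_from_to :: "ereal ^ 'n ^ 'n \<Rightarrow> 'n \<Rightarrow> 'n \<Rightarrow> 'n list \<Rightarrow> bool" where
  "path_from_to A i j p \<longleftrightarrow> walk_from_to A i j p \<and> distinct p"

definition mp_irreducible :: "ereal ^ 'n ^ 'n \<Rightarrow> bool" where
  "mp_irreducible A \<longleftrightarrow> (\<forall>i j. \<exists>p. walk_from_to A i j p)"

definition is_cycle :: "ereal ^ 'n ^ 'n \<Rightarrow> 'n list \<Rightarrow> bool" where
  "is_cycle A p \<longleftrightarrow> is_walk A p \<and> hd p = last p"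

definition mean_weight :: "ereal ^ 'n ^ 'n \<Rightarrow> 'n list \<Rightarrow> ereal" where
  "mean_weight A p = walk_weight A p / ereal (real (walk_length p))"

definition elementary_cycle :: "ereal ^ 'n ^ 'n \<Rightarrow> 'n list \<Rightarrow> bool" where
  "elementary_cycle A p \<longleftrightarrow> is_cycle A p \<and> walk_length p \<ge> 1 \<and> distinct (tl p)"

definition critical_cycle :: "ereal ^ 'n ^ 'n \<Rightarrow> 'n list \<Rightarrow> bool" where
  "critical_cycle A p \<longleftrightarrow> elementary_cycle A p \<and>
     (\<forall>q. is_cycle A q \<and> walk_length q \<ge> 1 \<longrightarrow> mean_weight A q \<le> mean_weight A p)"

text \<open>
  The list \<open>[c, c]\<close> is the loop at \<open>c\<close>.  A longer critical cycle would contribute all its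
  rotations, so uniqueness as a node sequence and uniqueness up to rotation agree here.
\<close>

definition unique_critical_loop :: "ereal ^ 'n ^ 'n \<Rightarrow> 'n \<Rightarrow> bool" where
  "unique_critical_loop A c \<longleftrightarrow>
     {p. critical_cycle A p} = {[c, c]} \<and> walk_weight A [c, c] = 0"

definition sup_matrix :: "(ereal ^ 'n ^ 'n) set \<Rightarrow> ereal ^ 'n ^ 'n" where
  "sup_matrix X = (\<chi> i j. SUP A\<in>X. A $ i $ j)"

definition inf_matrix :: "(ereal ^ 'n ^ 'n) set \<Rightarrow> ereal ^ 'n ^ 'n" where
  "inf_matrix X = (\<chi> i j. INF A\<in>X. A $ i $ j)"

text \<open>
  An entry \<open>\<infinity>\<close> of \<open>sup_matrix X\<close> need not be excluded separately: by irreducibility it would lie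
  on a cycle of mean weight \<open>\<infinity>\<close>, contradicting the last conjunct.
\<close>

definition standing_assumptions :: "(ereal ^ 'n ^ 'n) set \<Rightarrow> 'n \<Rightarrow> bool" where
  "standing_assumptions X c \<longleftrightarrow>
     X \<noteq> {} \<and> (\<forall>A\<in>X. over_rmax A) \<and>
     (\<forall>A\<in>X. mp_irreducible A) \<and>
     (\<forall>A\<in>X. \<forall>B\<in>X. geom_equiv A B) \<and>
     (\<forall>A\<in>X. geom_equiv (inf_matrix X) A) \<and>
     (\<forall>A\<in>X. unique_critical_loop A c) \<and>
     unique_critical_loop (sup_matrix X) c"

text \<open>
  The suprema below express maxima, with the convention that the maximum over the empty set
  is \<open>-\<infinity>\<close>, the least element of \<open>ereal\<close>.
  In \<open>lambda_star\<close> the list \<open>p = [i\<^sub>1, \<dots>, i\<^sub>r]\<close> stands for the closed sequence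
  \<open>i\<^sub>1, \<dots>, i\<^sub>r, i\<^sub>1\<close> in the complement of \<open>c\<close>; sequences using a non-edge have weight \<open>-\<infinity>\<close>.
\<close>

definition lambda_star :: "(ereal ^ 'n ^ 'n) set \<Rightarrow> 'n \<Rightarrow> ereal" where
  "lambda_star X c =
     (SUP p\<in>{p. p \<noteq> [] \<and> c \<notin> set p}. mean_weight (sup_matrix X) (p @ [hd p]))"

definition alpha :: "(ereal ^ 'n ^ 'n) set \<Rightarrow> 'n \<Rightarrow> 'n \<Rightarrow> ereal" where
  "alpha X c i =
     (SUP p\<in>{p. path_from_to (sup_matrix X) i c p}. walk_weight (sup_matrix X) p)"

definition beta :: "(ereal ^ 'n ^ 'n) set \<Rightarrow> 'n \<Rightarrow> 'n \<Rightarrow> ereal" where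
  "beta X c j =
     (SUP p\<in>{p. path_from_to (sup_matrix X) c j p}. walk_weight (sup_matrix X) p)"

definition gamma :: "(ereal ^ 'n ^ 'n) set \<Rightarrow> 'n \<Rightarrow> 'n \<Rightarrow> 'n \<Rightarrow> ereal" where
  "gamma X c i j =
     (SUP p\<in>{p. path_from_to (sup_matrix X) i j p \<and> c \<notin> set p}. walk_weight (sup_matrix X) p)"

definition w_inf :: "(ereal ^ 'n ^ 'n) set \<Rightarrow> 'n \<Rightarrow> nat \<Rightarrow> 'n \<Rightarrow> ereal" where
  "w_inf X c k i =
     (SUP p\<in>{p. walk_from_to (inf_matrix X) i c p \<and> walk_length p \<le> k}.
        walk_weight (inf_matrix X) p)"

definition v_inf :: "(ereal ^ 'n ^ 'n) set \<Rightarrow> 'n \<Rightarrow> nat \<Rightarrow> 'n \<Rightarrow> ereal" where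
  "v_inf X c k j =
     (SUP p\<in>{p. walk_from_to (inf_matrix X) c j p \<and> walk_length p \<le> k}.
        walk_weight (inf_matrix X) p)"

text \<open>
  Quotients by \<open>\<lambda>\<^sup>*\<close>, which is negative under the standing assumptions.  A value
  \<open>\<gamma> = -\<infinity>\<close> takes precedence over the other degenerate cases and imposes no condition.
\<close>

definition lambda_quot :: "ereal \<Rightarrow> ereal \<Rightarrow> ereal" where
  "lambda_quot a l = (if l = -\<infinity> then 0 else if a = -\<infinity> then \<infinity> else a / l)"

definition gamma_quot :: "(ereal ^ 'n ^ 'n) set \<Rightarrow> 'n \<Rightarrow> nat \<Rightarrow> 'n \<Rightarrow> 'n \<Rightarrow> ereal" where
  "gamma_quot X c k i j =
     (if gamma X c i j = -\<infinity> then -\<infinity>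
      else lambda_quot (w_inf X c k i + v_inf X c k j - gamma X c i j) (lambda_star X c))"

definition alpha_beta_quot :: "(ereal ^ 'n ^ 'n) set \<Rightarrow> 'n \<Rightarrow> nat \<Rightarrow> 'n \<Rightarrow> 'n \<Rightarrow> ereal" where
  "alpha_beta_quot X c k i j =
     lambda_quot (w_inf X c k i - alpha X c i + v_inf X c k j - beta X c j) (lambda_star X c)"

end

theory Submission
  imports Defs
begin

text \<open>
  The entry \<open>(i, j)\<close> of a product of \<open>k\<close> factors is the largest weight of a walk of length \<open>k\<close>
  from \<open>i\<close> to \<open>j\<close> whose \<open>t\<close>-th step is charged by the \<open>t\<close>-th factor.  Every factor gives the loop
  at \<open>c\<close> weight 0, so such a walk may wait at \<open>c\<close> for free, whereas any closed walk has weight at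
  most 0, already with the weights of the entrywise supremum.  Write \<open>\<Gamma>\<close> for the product.

  An optimal walk from \<open>i\<close> to \<open>j\<close> that visits \<open>c\<close> splits there into an arrival at \<open>c\<close> and a
  departure from \<open>c\<close>.  Padding both with loops at \<open>c\<close> bounds the entry by
  \<open>\<Gamma>\<^bsub>ic\<^esub> + \<Gamma>\<^bsub>cj\<^esub>\<close> (\<open>arrival_weight_le\<close>, \<open>departure_weight_le\<close>).  A walk that avoids \<open>c\<close>
  reduces to a path by excising cycles that avoid \<open>c\<close>, at a price of at least \<open>\<bar>\<lambda>\<^sup>*\<bar>\<close> per step
  (\<open>walk_excise_cycles\<close>).  By the first part of the hypothesis on \<open>k\<close> it is then lighter than
  \<open>w\<^sub>i + v\<^sub>j\<close>, which is at most \<open>\<Gamma>\<^bsub>ic\<^esub> + \<Gamma>\<^bsub>cj\<^esub>\<close>.  This gives \<open>product_entry_le\<close>.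

  For the converse inequality \<open>product_entry_ge\<close>, an optimal walk from \<open>i\<close> to \<open>c\<close> loses nothing if
  it waits at \<open>c\<close> after its first visit.  Up to that visit only the last node is \<open>c\<close>, so the same
  excision shows that a late first visit makes the walk lighter than \<open>w\<^sub>i\<close>.  Hence the first visit
  is early (\<open>early_arrival\<close>), and in the same way the last visit to \<open>c\<close> of an optimal walk from
  \<open>c\<close> to \<open>j\<close> is late (\<open>late_departure\<close>).  The second part of the hypothesis on \<open>k\<close> puts the early
  arrival before the late departure, so the two walks can be joined by waiting at \<open>c\<close>.

  The case \<open>\<lambda>\<^sup>* = -\<infinity>\<close>, in which no cycle avoids \<open>c\<close>, needs no separate argument: the proofs use a
  negative real rate \<open>l \<ge> \<lambda>\<^sup>*\<close> in place of \<open>\<lambda>\<^sup>*\<close>, and \<open>threshold_rate\<close> finds one for which the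
  hypothesis on \<open>k\<close> turns into the two real inequalities that are needed.
\<close>

section \<open>Weights of walks\<close>

lemma walk_weight_single [simp]: "walk_weight B [x] = 0"
  by (simp add: walk_weight_def)

lemma walk_weight_Cons [simp]:
  "walk_weight B (x # y # ys) = B $ x $ y + walk_weight B (y # ys)"
  by (simp add: walk_weight_def)

lemma is_walk_single [simp]: "is_walk B [x]"
  by (simp add: is_walk_def)

lemma is_walk_Cons [simp]:
  "is_walk B (x # y # ys) \<longleftrightarrow> B $ x $ y \<noteq> -\<infinity> \<and> is_walk B (y # ys)"
  by (simp add: is_walk_def edges_def)

lemma walk_weight_append:
  "walk_weight B (xs @ y # zs) = walk_weight B (xs @ [y]) + walk_weight B (y # zs)"
proof (induction xs)
  case (Cons x xs)
  then show ?case by (cases xs) (auto simp: add.assoc)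
qed simp

lemma is_walk_append:
  "is_walk B (xs @ y # zs) \<longleftrightarrow> is_walk B (xs @ [y]) \<and> is_walk B (y # zs)"
proof (induction xs)
  case (Cons x xs)
  then show ?case by (cases xs) auto
qed simp

lemma walk_weight_finite:
  assumes "over_rmax B" "is_walk B p"
  shows "\<bar>walk_weight B p\<bar> \<noteq> \<infinity>"
  using assms(2)
proof (induction p rule: induct_list012)
  case (3 x y zs)
  then show ?case
    using assms(1) by (cases "B $ x $ y"; cases "walk_weight B (y # zs)") (auto simp: over_rmax_def)
qed (auto simp: is_walk_def)

lemma walk_weight_non_walk:
  assumes "over_rmax B" "p \<noteq> []" "\<not> is_walk B p"
  shows "walk_weight B p = -\<infinity>"
proof -
  have *: "walk_weight B q \<noteq> \<infinity>" if "q \<noteq> []" for q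
    using that
  proof (induction q rule: induct_list012)
    case (3 x y zs)
    then show ?case using assms(1) by (auto simp: over_rmax_def)
  qed auto
  show ?thesis using assms(2,3)
  proof (induction p rule: induct_list012)
    case (3 x y zs)
    have "walk_weight B (y # zs) \<noteq> \<infinity>" "B $ x $ y \<noteq> \<infinity>"
      using * assms(1) by (auto simp: over_rmax_def)
    then show ?case using 3 by (cases "B $ x $ y"; cases "walk_weight B (y # zs)") auto
  qed auto
qed

lemma walk_weight_mono:
  assumes "\<And>i j. B $ i $ j \<le> C $ i $ j"
  shows "walk_weight B p \<le> walk_weight C p"
  by (induction p rule: induct_list012) (auto simp: walk_weight_def intro: add_mono assms)

text \<open>
  Walks through a product are functions of time rather than lists, since the weight of a step
  depends on when it is taken.  The shift by one matches the factors being numbered from 1.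
\<close>
definition seg_weight :: "(nat \<Rightarrow> ereal ^ 'n ^ 'n) \<Rightarrow> (nat \<Rightarrow> 'n) \<Rightarrow> nat \<Rightarrow> nat \<Rightarrow> ereal" where
  "seg_weight A p s t = (\<Sum>u=s..<t. A (Suc u) $ p u $ p (Suc u))"

lemma seg_weight_split:
  assumes "s \<le> m" "m \<le> t"
  shows "seg_weight A p s t = seg_weight A p s m + seg_weight A p m t"
  using assms by (simp add: seg_weight_def sum.atLeastLessThan_concat)

lemma seg_weight_cong:
  assumes "\<And>u. s \<le> u \<Longrightarrow> u \<le> t \<Longrightarrow> p u = q u"
  shows "seg_weight A p s t = seg_weight A q s t"
  unfolding seg_weight_def by (rule sum.cong) (auto simp: assms)

lemma seg_weight_stay:
  assumes "\<And>u. s \<le> u \<Longrightarrow> u \<le> t \<Longrightarrow> p u = c"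
    and "\<And>u. s \<le> u \<Longrightarrow> u < t \<Longrightarrow> A (Suc u) $ c $ c = 0"
  shows "seg_weight A p s t = 0"
  unfolding seg_weight_def by (rule sum.neutral) (auto simp: assms)

lemma seg_weight_mono:
  assumes "\<And>u i j. s \<le> u \<Longrightarrow> u < t \<Longrightarrow> A (Suc u) $ i $ j \<le> B (Suc u) $ i $ j"
  shows "seg_weight A p s t \<le> seg_weight B p s t"
  unfolding seg_weight_def by (rule sum_mono) (auto simp: assms)

lemma seg_weight_const:
  assumes "s \<le> t"
  shows "seg_weight (\<lambda>_. B) p s t = walk_weight B (map p [s..<Suc t])"
  using assms
proof (induction t rule: dec_induct)
  case base
  then show ?case by (simp add: seg_weight_def)
next
  case (step t)
  have "map p [s..<Suc (Suc t)] = map p [s..<t] @ p t # [p (Suc t)]"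
    using step by (simp add: upt_Suc)
  then have "walk_weight B (map p [s..<Suc (Suc t)]) =
      walk_weight B (map p [s..<Suc t]) + walk_weight B [p t, p (Suc t)]"
    using step walk_weight_append[of B "map p [s..<t]" "p t" "[p (Suc t)]"] by simp
  then show ?case
    using step by (simp add: seg_weight_def)
qed

lemma mp_prod_Suc_nth:
  "mp_prod A (Suc k) $ i $ j = (MAX m. mp_prod A k $ i $ m + A (Suc k) $ m $ j)"
  by (simp add: mp_mult_def)

lemma seg_weight_le_mp_prod:
  assumes "p 0 = i" "p k = j"
  shows "seg_weight A p 0 k \<le> mp_prod A k $ i $ j"
  using assms(2)
proof (induction k arbitrary: j)
  case 0
  then show ?case using assms(1) by (simp add: seg_weight_def mp_one_def)
next
  case (Suc k)
  have "seg_weight A p 0 (Suc k) = seg_weight A p 0 k + A (Suc k) $ p k $ j"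
    using Suc.prems by (simp add: seg_weight_def)
  also have "\<dots> \<le> mp_prod A k $ i $ p k + A (Suc k) $ p k $ j"
    by (intro add_right_mono Suc.IH) simp
  also have "\<dots> \<le> mp_prod A (Suc k) $ i $ j"
    unfolding mp_prod_Suc_nth by (rule Max_ge) auto
  finally show ?case .
qed

lemma mp_prod_attained:
  assumes "mp_prod A k $ i $ j \<noteq> -\<infinity>" "\<And>t. t \<in> {1..k} \<Longrightarrow> over_rmax (A t)"
  obtains p where "p 0 = i" "p k = j" "mp_prod A k $ i $ j = seg_weight A p 0 k"
  using assms
proof (induction k arbitrary: j thesis)
  case 0
  then show ?case
    by (auto simp: mp_one_def seg_weight_def split: if_splits)
next
  case (Suc k)
  have "mp_prod A (Suc k) $ i $ j \<in> range (\<lambda>m. mp_prod A k $ i $ m + A (Suc k) $ m $ j)"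
    unfolding mp_prod_Suc_nth by (rule Max_in) auto
  then obtain m where m: "mp_prod A (Suc k) $ i $ j = mp_prod A k $ i $ m + A (Suc k) $ m $ j"
    by blast
  show ?case
  proof (cases "mp_prod A k $ i $ m = -\<infinity>")
    case True
    moreover have "A (Suc k) $ m $ j \<noteq> \<infinity>"
      using Suc.prems(3)[of "Suc k"] by (simp add: over_rmax_def)
    ultimately show ?thesis
      using m Suc.prems(2) by (cases "A (Suc k) $ m $ j") auto
  next
    case False
    obtain p where p: "p 0 = i" "p k = m" "mp_prod A k $ i $ m = seg_weight A p 0 k"
      using Suc.IH[OF _ False] Suc.prems(3) by (metis atLeastAtMost_iff le_SucI)
    show ?thesis
    proof (rule Suc.prems(1)[of "p(Suc k := j)"])
      have "seg_weight A (p(Suc k := j)) 0 k = seg_weight A p 0 k"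
        by (rule seg_weight_cong) auto
      then show "mp_prod A (Suc k) $ i $ j = seg_weight A (p(Suc k := j)) 0 (Suc k)"
        using p m by (simp add: seg_weight_def)
    qed (use p in auto)
  qed
qed


lemma mp_prod_ne_pinf:
  assumes "\<And>t. t \<in> {1..k} \<Longrightarrow> over_rmax (A t)"
  shows "mp_prod A k $ i $ j \<noteq> \<infinity>"
proof
  assume inf: "mp_prod A k $ i $ j = \<infinity>"
  then obtain p where "mp_prod A k $ i $ j = seg_weight A p 0 k"
    using mp_prod_attained assms by (metis MInfty_neq_PInfty(1))
  moreover have "seg_weight A p 0 k \<noteq> \<infinity>"
    using assms by (auto simp: seg_weight_def sum_Pinfty over_rmax_def)
  ultimately show False using inf by simp
qed

section \<open>Removing cycles\<close>

lemma walk_weight_snoc: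
  "xs \<noteq> [] \<Longrightarrow> walk_weight B (xs @ [y]) = walk_weight B xs + B $ last xs $ y"
  using walk_weight_append[of B "butlast xs" "last xs" "[y]"]
  by (cases xs rule: rev_cases) auto

lemma is_walk_snoc:
  "xs \<noteq> [] \<Longrightarrow> is_walk B (xs @ [y]) \<longleftrightarrow> is_walk B xs \<and> B $ last xs $ y \<noteq> -\<infinity>"
  using is_walk_append[of B "butlast xs" "last xs" "[y]"]
  by (cases xs rule: rev_cases) auto

text \<open>
  If a node repeats, the stretch between two of its occurrences is a closed walk, and cutting it
  out leaves a shorter walk with the same ends.  The stretch need not be an elementary cycle,
  but the induction hypothesis turns it, short of its last step, into a path, which the last step
  closes to an elementary cycle.  A bound on elementary cycles within \<open>N\<close> therefore suffices.
  The set \<open>N\<close> is the complement of \<open>c\<close> for the cycle bounds, and everything for the mere existence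
  of paths.
\<close>
lemma walk_excise_cycles:
  fixes l :: real
  assumes "is_walk B p" "set p \<subseteq> N"
    and cyc: "\<And>ys. ys \<noteq> [] \<Longrightarrow> set ys \<subseteq> N \<Longrightarrow> distinct ys \<Longrightarrow> is_walk B (ys @ [hd ys])
      \<Longrightarrow> walk_weight B (ys @ [hd ys]) \<le> ereal (l * real (length ys))"
  obtains q where "path_from_to B (hd p) (last p) q" "set q \<subseteq> N"
    "walk_weight B p \<le> walk_weight B q + ereal (l * (real (length p) - real (length q)))"
proof -
  have "\<exists>q. path_from_to B (hd p) (last p) q \<and> set q \<subseteq> N \<and>
    walk_weight B p \<le> walk_weight B q + ereal (l * (real (length p) - real (length q)))"
    using assms(1,2)
  proof (induction "length p" arbitrary: p rule: less_induct)
    case less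
    show ?case
    proof (cases "distinct p")
      case True
      then show ?thesis using less
        by (intro exI[of _ p]) (simp add: path_from_to_def walk_from_to_def)
    next
      case False
      then obtain xs ys zs y where p: "p = xs @ y # ys @ y # zs"
        using not_distinct_decomp[OF False] by auto
      let ?C = "y # ys" and ?D = "xs @ y # zs"
      have walks: "is_walk B (xs @ [y])" "is_walk B (?C @ [y])" "is_walk B (y # zs)"
        using less.prems(1) is_walk_append[of B xs y "ys @ y # zs"] is_walk_append[of B ?C y zs]
        unfolding p by auto
      have weight: "walk_weight B p = walk_weight B ?D + walk_weight B (?C @ [y])"
        using walk_weight_append[of B xs y "ys @ y # zs"] walk_weight_append[of B ?C y zs]
          walk_weight_append[of B xs y zs]
        unfolding p by (simp add: ac_simps)
      have C: "is_walk B ?C" and ret: "B $ last ?C $ y \<noteq> -\<infinity>"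
        using walks(2) is_walk_snoc[of ?C B y] by auto
      have "length ?C < length p" "set ?C \<subseteq> N" using p less.prems(2) by auto
      from less.hyps[OF this(1) C this(2)] obtain q where q: "path_from_to B y (last ?C) q"
          "set q \<subseteq> N" "walk_weight B ?C \<le>
            walk_weight B q + ereal (l * (real (length ?C) - real (length q)))"
        by (metis list.sel(1))
      have q': "q \<noteq> []" "distinct q" "is_walk B q" "hd q = y" "last q = last ?C"
        using q(1) by (auto simp: path_from_to_def walk_from_to_def is_walk_def)
      have "walk_weight B (?C @ [y]) = walk_weight B ?C + B $ last ?C $ y"
        using walk_weight_snoc[of ?C B y] by simp
      also have "\<dots> \<le> walk_weight B q + ereal (l * (real (length ?C) - real (length q)))
          + B $ last ?C $ y"
        by (intro add_right_mono q)
      also have "\<dots> = walk_weight B (q @ [hd q])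
          + ereal (l * (real (length ?C) - real (length q)))"
        using walk_weight_snoc[of q B y] q' by (simp add: ac_simps)
      also have "\<dots> \<le> ereal (l * real (length q))
          + ereal (l * (real (length ?C) - real (length q)))"
        using cyc[of q] q q' ret by (intro add_right_mono) (simp add: is_walk_snoc)
      also have "\<dots> = ereal (l * real (length ?C))"
        by (simp add: algebra_simps)
      finally have cw: "walk_weight B (?C @ [y]) \<le> ereal (l * real (length ?C))" .
      have D: "length ?D < length p" "is_walk B ?D" "set ?D \<subseteq> N"
        using walks less.prems(2) is_walk_append[of B xs y zs] by (auto simp: p)
      have ends: "hd ?D = hd p" "last ?D = last p"
        by (auto simp: p hd_append)
      from less.hyps[OF D] obtain r where r: "path_from_to B (hd p) (last p) r" "set r \<subseteq> N"
          "walk_weight B ?D \<le> walk_weight B r + ereal (l * (real (length ?D) - real (length r)))"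
        unfolding ends by blast
      have "walk_weight B p \<le> (walk_weight B r + ereal (l * (real (length ?D) - real (length r))))
          + ereal (l * real (length ?C))"
        unfolding weight by (intro add_mono r cw)
      also have "\<dots> = walk_weight B r + ereal (l * (real (length p) - real (length r)))"
        by (simp add: p add.assoc algebra_simps)
      finally show ?thesis using r by blast
    qed
  qed
  then show ?thesis using that by blast
qed

text \<open>
  Excising cycles from a closed walk leaves the path of length 0 at its start.
\<close>
lemma closed_walk_weight_le:
  fixes l :: real
  assumes "is_walk B (p @ [hd p])" "p \<noteq> []" "set p \<subseteq> N"
    and cyc: "\<And>ys. ys \<noteq> [] \<Longrightarrow> set ys \<subseteq> N \<Longrightarrow> distinct ys \<Longrightarrow> is_walk B (ys @ [hd ys])
      \<Longrightarrow> walk_weight B (ys @ [hd ys]) \<le> ereal (l * real (length ys))"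
  shows "walk_weight B (p @ [hd p]) \<le> ereal (l * real (length p))"
proof -
  have "set (p @ [hd p]) \<subseteq> N" using assms by auto
  from walk_excise_cycles[OF assms(1) this cyc] obtain q where
    q: "path_from_to B (hd p) (hd p) q"
    "walk_weight B (p @ [hd p]) \<le> walk_weight B q
       + ereal (l * (real (length (p @ [hd p])) - real (length q)))"
    using assms(2) by (auto simp: hd_append)
  then have "q \<noteq> []" "distinct q" "hd q = last q"
    by (auto simp: path_from_to_def walk_from_to_def is_walk_def)
  then have "q = [hd q]"
    by (cases q) (auto split: if_splits)
  then have "length q = 1" "walk_weight B q = 0"
    by (metis One_nat_def length_Cons list.size(3), metis walk_weight_single)
  then show ?thesis using q(2) by simp
qed

section \<open>The threshold inequality\<close>

text \<open>
  For finite \<open>L\<close> the rate is \<open>L\<close> itself, and multiplying the two bounds on \<open>k\<close> by \<open>L < 0\<close> gives the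
  claim; a numerator \<open>-\<infinity>\<close> would make the quotient infinite, so \<open>w\<close> and \<open>v\<close> are finite.
  For \<open>L = -\<infinity>\<close> the bounds say only that \<open>k\<close> exceeds \<open>m\<close> (unless \<open>g = -\<infinity>\<close>) and \<open>2 m\<close>.  Being integers, the differences are at least
  1, so any sufficiently negative rate will do.
\<close>
lemma threshold_rate:
  fixes L w v g a b :: ereal and k m :: nat
  assumes L: "L < 0" and w: "w \<noteq> \<infinity>" and v: "v \<noteq> \<infinity>" and g: "g \<noteq> \<infinity>"
    and a: "\<bar>a\<bar> \<noteq> \<infinity>" and b: "\<bar>b\<bar> \<noteq> \<infinity>"
    and reach: "m \<le> k \<Longrightarrow> w \<noteq> -\<infinity> \<and> v \<noteq> -\<infinity>"
    and kg: "(if g = -\<infinity> then -\<infinity> else lambda_quot (w + v - g) L) + ereal (real m) < ereal (real k)"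
    and kab: "lambda_quot (w - a + v - b) L + ereal (2 * real m) < ereal (real k)"
  obtains l :: real where "l < 0" "L \<le> ereal l" "\<bar>w\<bar> \<noteq> \<infinity>" "\<bar>v\<bar> \<noteq> \<infinity>"
    "g + ereal (l * (real k - real m)) < w + v"
    "a + b + ereal (l * (real k - 2 * real m)) < w + v"
proof -
  obtain a' b' where ab: "a = ereal a'" "b = ereal b'"
    using a b by auto
  have "\<exists>l<0. L \<le> ereal l \<and> w \<noteq> -\<infinity> \<and> v \<noteq> -\<infinity> \<and> (\<forall>w' v' g'. w = ereal w' \<longrightarrow> v = ereal v' \<longrightarrow>
      (g = ereal g' \<longrightarrow> g' + l * (real k - real m) < w' + v') \<and>
      a' + b' + l * (real k - 2 * real m) < w' + v')"
  proof (cases "L = -\<infinity>")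
    case True
    then have k: "2 * m + 1 \<le> k" using kab by (simp add: lambda_quot_def)
    define w' v' g' where "w' = real_of_ereal w" and "v' = real_of_ereal v"
      and "g' = real_of_ereal g"
    define l where "l = - (\<bar>w' + v' - g'\<bar> + \<bar>w' + v' - a' - b'\<bar> + 1)"
    have l: "l < 0" by (simp add: l_def)
    have "l * (real k - real m) \<le> l * 1" "l * (real k - 2 * real m) \<le> l * 1"
      using l k by (intro mult_left_mono_neg; linarith)+
    moreover have "g' + l < w' + v'" "a' + b' + l < w' + v'"
      unfolding l_def by linarith+
    ultimately have "g' + l * (real k - real m) < w' + v'"
        "a' + b' + l * (real k - 2 * real m) < w' + v'"
      by linarith+
    moreover have "w \<noteq> -\<infinity> \<and> v \<noteq> -\<infinity>" using reach k by simp
    ultimately show ?thesis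
      using l True unfolding w'_def v'_def g'_def by (intro exI[of _ l]) auto
  next
    case False
    then obtain l where l: "L = ereal l" "l < 0" using L by (cases L) auto
    have num: "w - a + v - b \<noteq> -\<infinity>"
      using kab l by (auto simp: lambda_quot_def)
    have fin: "w \<noteq> -\<infinity>" "v \<noteq> -\<infinity>"
      using num w v unfolding ab by (cases w; cases v; simp)+
    have 1: "a' + b' + l * (real k - 2 * real m) < w' + v'" if "w = ereal w'" "v = ereal v'" for w' v'
    proof -
      have "(w' - a' + v' - b') / l + 2 * real m < real k"
        using kab l(2) unfolding l(1) ab that by (simp add: lambda_quot_def)
      then have "real k * l < ((w' - a' + v' - b') / l + 2 * real m) * l"
        using l(2) by (rule mult_strict_right_mono_neg)
      also have "\<dots> = (w' - a' + v' - b') + 2 * real m * l"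
        using l(2) by (simp add: distrib_right)
      finally show ?thesis by (simp add: algebra_simps)
    qed
    have 2: "g' + l * (real k - real m) < w' + v'"
      if "w = ereal w'" "v = ereal v'" "g = ereal g'" for g' w' v'
    proof -
      have "(w' + v' - g') / l + real m < real k"
        using kg l(2) unfolding l(1) that by (simp add: lambda_quot_def)
      then have "real k * l < ((w' + v' - g') / l + real m) * l"
        using l(2) by (rule mult_strict_right_mono_neg)
      also have "\<dots> = (w' + v' - g') + real m * l"
        using l(2) by (simp add: distrib_right)
      finally show ?thesis by (simp add: algebra_simps)
    qed
    show ?thesis
      using l fin 1 2 by (intro exI[of _ l]) simp
  qed
  then obtain l w' v' where l: "l < 0" "L \<le> ereal l" and wv: "w = ereal w'" "v = ereal v'"
    and g': "\<And>g'. g = ereal g' \<Longrightarrow> g' + l * (real k - real m) < w' + v'"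
    and ab': "a' + b' + l * (real k - 2 * real m) < w' + v'"
    using w v by (metis ereal_cases)
  have "g + ereal (l * (real k - real m)) < w + v"
    using g g' unfolding wv by (cases g) simp_all
  moreover have "a + b + ereal (l * (real k - 2 * real m)) < w + v"
    using ab' unfolding wv ab by simp
  ultimately show ?thesis
    using that[of l] l unfolding wv by simp
qed

section \<open>Consequences of the standing assumptions\<close>

lemma SUP_finite_cases:
  fixes f :: "'b \<Rightarrow> ereal"
  assumes "finite F" "\<And>x. x \<in> F \<Longrightarrow> \<bar>f x\<bar> \<noteq> \<infinity>"
  shows "(SUP x\<in>F. f x) \<noteq> \<infinity>" "F \<noteq> {} \<Longrightarrow> (SUP x\<in>F. f x) \<noteq> -\<infinity>"
proof -
  have *: "(SUP x\<in>F. f x) \<in> f ` F" if "F \<noteq> {}"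
    using assms(1) that Max_Sup[of "f ` F"] Max_in[of "f ` F"] by simp
  show "F \<noteq> {} \<Longrightarrow> (SUP x\<in>F. f x) \<noteq> -\<infinity>"
    using * assms(2) by fastforce
  show "(SUP x\<in>F. f x) \<noteq> \<infinity>"
    using * assms(2) by (cases "F = {}") (fastforce simp: bot_ereal_def)+
qed

lemma finite_paths: "finite {p :: 'n::finite list. distinct p \<and> P p}"
  by (rule finite_subset[OF _ finite_subset_distinct[of UNIV]]) auto

lemma finite_bounded_walks: "finite {p :: 'n::finite list. P p \<and> walk_length p \<le> k}"
proof (rule finite_subset[OF _ finite_lists_length_le[of UNIV "Suc k"]])
  show "{p :: 'n list. P p \<and> walk_length p \<le> k} \<subseteq> {xs. set xs \<subseteq> UNIV \<and> length xs \<le> Suc k}"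
    by (auto simp: walk_length_def)
qed simp

locale standing =
  fixes X :: "(ereal ^ 'n ^ 'n) set" and c :: 'n
  assumes std: "standing_assumptions X c"
begin

abbreviation "S \<equiv> sup_matrix X"
abbreviation "I \<equiv> inf_matrix X"

lemma le_sup: "B \<in> X \<Longrightarrow> B $ i $ j \<le> S $ i $ j"
  unfolding sup_matrix_def by (auto intro: SUP_upper)

lemma inf_le: "B \<in> X \<Longrightarrow> I $ i $ j \<le> B $ i $ j"
  unfolding inf_matrix_def by (auto intro: INF_lower)

lemma nonempty: "X \<noteq> {}"
  and over_rmax_mem: "B \<in> X \<Longrightarrow> over_rmax B"
  and irreducible_mem: "B \<in> X \<Longrightarrow> mp_irreducible B"
  and edges_inf: "B \<in> X \<Longrightarrow> edges I = edges B"
  and unique_loop_mem: "B \<in> X \<Longrightarrow> unique_critical_loop B c"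
  and unique_loop_sup: "unique_critical_loop S c"
  using std unfolding standing_assumptions_def geom_equiv_def by blast+

lemma inf_le_sup: "I $ i $ j \<le> S $ i $ j"
proof -
  obtain B where "B \<in> X" using nonempty by blast
  then show ?thesis using order_trans[OF inf_le le_sup] by blast
qed

lemma loop_mem: "B \<in> X \<Longrightarrow> B $ c $ c = 0"
  using unique_loop_mem[of B] by (simp add: unique_critical_loop_def)

lemma loop_sup: "S $ c $ c = 0"
  using unique_loop_sup by (simp add: unique_critical_loop_def)

lemma critical_sup: "critical_cycle S p \<longleftrightarrow> p = [c, c]"
  using unique_loop_sup unfolding unique_critical_loop_def by blast

lemma over_rmax_inf: "over_rmax I"
proof -
  obtain B where B: "B \<in> X" using nonempty by blast
  have "I $ i $ j \<noteq> \<infinity>" for i j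
  proof
    assume "I $ i $ j = \<infinity>"
    then have "B $ i $ j = \<infinity>" using inf_le[OF B, of i j] by simp
    then show False using over_rmax_mem[OF B] by (simp add: over_rmax_def)
  qed
  then show ?thesis by (simp add: over_rmax_def)
qed

lemma connected_inf: "\<exists>p. walk_from_to I i j p"
proof -
  obtain B where "B \<in> X" using nonempty by blast
  then have "edges I = edges B" "mp_irreducible B"
    using edges_inf irreducible_mem by blast+
  then show ?thesis by (simp add: mp_irreducible_def walk_from_to_def is_walk_def)
qed

lemma walk_inf_imp_sup: "is_walk I p \<Longrightarrow> is_walk S p"
proof -
  have "edges I \<subseteq> edges S"
  proof -
    have "I $ i $ j = -\<infinity>" if "S $ i $ j = -\<infinity>" for i j
      using inf_le_sup[of i j] that by simp
    then show ?thesis by (auto simp: edges_def)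
  qed
  then show "is_walk I p \<Longrightarrow> is_walk S p"
    unfolding is_walk_def by (auto elim: successively_mono)
qed

lemma closed_weight_le_0:
  assumes "is_walk S (p @ [hd p])" "p \<noteq> []"
  shows "walk_weight S (p @ [hd p]) \<le> 0"
proof -
  let ?q = "p @ [hd p]"
  have "is_cycle S ?q" "walk_length ?q \<ge> 1"
    using assms by (cases p; simp add: is_cycle_def walk_length_def)+
  then have "mean_weight S ?q \<le> mean_weight S [c, c]"
    using critical_sup[of "[c, c]"] by (simp add: critical_cycle_def)
  also have "\<dots> = 0"
    using loop_sup by (simp add: mean_weight_def)
  finally have "walk_weight S ?q / ereal (real (length p)) \<le> 0"
    by (simp add: mean_weight_def walk_length_def)
  moreover have "real (length p) > 0" using assms by simp
  ultimately show ?thesis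
    by (cases "walk_weight S ?q") (auto simp: field_simps)
qed

text \<open>
  The supremum of infinitely many finite entries could be infinite.  By strong connectedness such
  an entry would lie on a closed walk of infinite weight, but these have weight at most 0.
\<close>
lemma over_rmax_sup: "over_rmax S"
  unfolding over_rmax_def
proof (intro allI notI)
  fix i j
  assume inf: "S $ i $ j = \<infinity>"
  obtain p where p: "walk_from_to S j i p"
    using connected_inf walk_inf_imp_sup by (metis walk_from_to_def)
  then have ne: "p \<noteq> []" and walk: "is_walk S p" and ends: "hd p = j" "last p = i"
    by (auto simp: walk_from_to_def is_walk_def)
  have "is_walk S (p @ [hd p])"
    using ne walk ends inf by (simp add: is_walk_snoc)
  moreover have "walk_weight S (p @ [hd p]) = \<infinity>"
    using ne ends inf by (simp add: walk_weight_snoc)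
  ultimately show False using closed_weight_le_0 ne by force
qed

lemma walk_sup_finite: "is_walk S p \<Longrightarrow> \<bar>walk_weight S p\<bar> \<noteq> \<infinity>"
  by (rule walk_weight_finite[OF over_rmax_sup])

text \<open>
  A cycle of weight 0 has the same mean as the loop at \<open>c\<close>, so it would be a second critical cycle.
\<close>
lemma elementary_weight_neg:
  assumes "is_walk S (p @ [hd p])" "p \<noteq> []" "distinct p" "c \<notin> set p"
  shows "walk_weight S (p @ [hd p]) < 0"
proof (rule ccontr)
  let ?q = "p @ [hd p]"
  assume "\<not> walk_weight S ?q < 0"
  then have "walk_weight S ?q = 0"
    using closed_weight_le_0[OF assms(1,2)] by (metis antisym not_less)
  then have "mean_weight S ?q = mean_weight S [c, c]"
    using loop_sup by (simp add: mean_weight_def)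
  moreover have "elementary_cycle S ?q"
    using assms by (cases p) (auto simp: elementary_cycle_def is_cycle_def walk_length_def)
  moreover have "critical_cycle S [c, c]"
    using critical_sup[of "[c, c]"] by simp
  ultimately have "critical_cycle S ?q"
    unfolding critical_cycle_def by metis
  then have "?q = [c, c]"
    using critical_sup[of ?q] by simp
  then show False
    using assms by (cases p) auto
qed

text \<open>
  The supremum ranges over infinitely many closed walks, so their being negative does not yet make
  it negative.  There are only finitely many elementary cycles, however, and the largest of their
  means bounds the mean of every closed walk that avoids \<open>c\<close>.
\<close>
lemma lambda_star_neg: "lambda_star X c < 0"
proof -
  define E where "E = {p. distinct p \<and> p \<noteq> [] \<and> c \<notin> set p \<and> is_walk S (p @ [hd p])}"
  define h where "h = (\<lambda>p. real_of_ereal (walk_weight S (p @ [hd p])) / real (length p))"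
  \<comment> \<open>Inserting -1 gives a negative value also when no cycle avoids \<open>c\<close>.\<close>
  define \<mu> where "\<mu> = Max (insert (-1) (h ` E))"
  have fin: "finite E" unfolding E_def by (rule finite_paths)
  have "h p < 0" if "p \<in> E" for p
  proof -
    have "walk_weight S (p @ [hd p]) < 0"
      using that elementary_weight_neg by (auto simp: E_def)
    moreover have "\<bar>walk_weight S (p @ [hd p])\<bar> \<noteq> \<infinity>"
      using that by (intro walk_sup_finite) (auto simp: E_def)
    moreover have "length p > 0" using that by (simp add: E_def)
    ultimately show ?thesis
      unfolding h_def by (cases "walk_weight S (p @ [hd p])") (auto simp: divide_less_0_iff)
  qed
  then have neg: "\<mu> < 0"
    unfolding \<mu>_def using fin by (subst Max_less_iff) auto
  have elem: "walk_weight S (p @ [hd p]) \<le> ereal (\<mu> * real (length p))"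
    if "p \<noteq> []" "set p \<subseteq> - {c}" "distinct p" "is_walk S (p @ [hd p])" for p
  proof -
    have "p \<in> E" using that by (auto simp: E_def)
    then have "h p \<le> \<mu>" unfolding \<mu>_def using fin by (intro Max_ge) auto
    then have "real_of_ereal (walk_weight S (p @ [hd p])) \<le> \<mu> * real (length p)"
      using that(1) by (simp add: h_def divide_le_eq)
    then show ?thesis
      using walk_sup_finite[OF that(4)] by (cases "walk_weight S (p @ [hd p])") auto
  qed
  have "mean_weight S (p @ [hd p]) \<le> ereal \<mu>" if p: "p \<noteq> []" "c \<notin> set p" for p
  proof (cases "is_walk S (p @ [hd p])")
    case True
    have "walk_weight S (p @ [hd p]) \<le> ereal (\<mu> * real (length p))"
      using closed_walk_weight_le[OF True p(1), of "- {c}" \<mu>] elem p by auto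
    then show ?thesis
      using p walk_sup_finite[OF True]
      by (cases "walk_weight S (p @ [hd p])")
        (auto simp: mean_weight_def walk_length_def divide_le_eq)
  next
    case False
    then show ?thesis
      using p by (simp add: mean_weight_def walk_length_def
          walk_weight_non_walk[OF over_rmax_sup _ False])
  qed
  then have "lambda_star X c \<le> ereal \<mu>"
    unfolding lambda_star_def by (intro SUP_least) auto
  also have "\<dots> < 0" using neg by simp
  finally show ?thesis .
qed

lemma sup_path:
  assumes "is_walk S p"
  obtains q where "path_from_to S (hd p) (last p) q"
proof (rule walk_excise_cycles[of S p UNIV 0])
  show "walk_weight S (ys @ [hd ys]) \<le> ereal (0 * real (length ys))"
    if "ys \<noteq> []" "is_walk S (ys @ [hd ys])" for ys
    using closed_weight_le_0[OF that(2,1)] by (simp add: zero_ereal_def)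
qed (use assms that in auto)

lemma finite_alpha: "\<bar>alpha X c i\<bar> \<noteq> \<infinity>" and finite_beta: "\<bar>beta X c i\<bar> \<noteq> \<infinity>"
  and gamma_ne_pinf: "gamma X c i j \<noteq> \<infinity>"
proof -
  have path: "\<exists>q. path_from_to S i j q" for i j
    using sup_path connected_inf walk_inf_imp_sup by (metis walk_from_to_def)
  have fin: "finite {p. path_from_to S i j p}" "finite {p. path_from_to S i j p \<and> c \<notin> set p}" for i j
    using finite_paths[of "walk_from_to S i j"]
      finite_paths[of "\<lambda>p. walk_from_to S i j p \<and> c \<notin> set p"]
    by (simp_all add: path_from_to_def conj_ac)
  have real: "\<bar>walk_weight S p\<bar> \<noteq> \<infinity>" if "path_from_to S i j p" for i j p
    using that by (intro walk_sup_finite) (simp add: path_from_to_def walk_from_to_def)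
  show "\<bar>alpha X c i\<bar> \<noteq> \<infinity>"
    using SUP_finite_cases[OF fin(1)[of i c], of "walk_weight S"] real path[of i c]
    by (fastforce simp: alpha_def)
  show "\<bar>beta X c i\<bar> \<noteq> \<infinity>"
    using SUP_finite_cases[OF fin(1)[of c i], of "walk_weight S"] real path[of c i]
    by (fastforce simp: beta_def)
  show "gamma X c i j \<noteq> \<infinity>"
    using SUP_finite_cases(1)[OF fin(2)[of i j], of "walk_weight S"] real
    by (fastforce simp: gamma_def)
qed

lemma w_ne_pinf: "w_inf X c k i \<noteq> \<infinity>" and v_ne_pinf: "v_inf X c k j \<noteq> \<infinity>"
proof -
  have real: "\<bar>walk_weight I p\<bar> \<noteq> \<infinity>" if "walk_from_to I i j p" for i j p
    using that by (intro walk_weight_finite over_rmax_inf) (simp add: walk_from_to_def)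
  show "w_inf X c k i \<noteq> \<infinity>"
    unfolding w_inf_def by (rule SUP_finite_cases(1)[OF finite_bounded_walks]) (auto dest: real)
  show "v_inf X c k j \<noteq> \<infinity>"
    unfolding v_inf_def by (rule SUP_finite_cases(1)[OF finite_bounded_walks]) (auto dest: real)
qed

text \<open>
  A path has at most \<open>n - 1\<close> steps, so strong connectedness is visible within walks of length \<open>k\<close>.
\<close>
lemma wv_ne_minf:
  assumes "CARD('n) \<le> Suc k"
  shows "w_inf X c k i \<noteq> -\<infinity> \<and> v_inf X c k j \<noteq> -\<infinity>"
proof -
  have *: "\<exists>q. walk_from_to I i j q \<and> walk_length q \<le> k" for i j
  proof -
    obtain p where p: "walk_from_to I i j p" using connected_inf by blast
    then have "is_walk I p" by (simp add: walk_from_to_def)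
    moreover have "walk_weight I (ys @ [hd ys]) \<le> ereal (0 * real (length ys))"
      if "ys \<noteq> []" "is_walk I (ys @ [hd ys])" for ys
      using order_trans[OF walk_weight_mono[OF inf_le_sup] closed_weight_le_0[of ys]]
        walk_inf_imp_sup that by (simp add: zero_ereal_def)
    ultimately obtain q where q: "path_from_to I (hd p) (last p) q"
      using walk_excise_cycles[of I p UNIV 0] by blast
    then have "card (set q) = length q"
      by (intro distinct_card) (simp add: path_from_to_def)
    then have "length q \<le> CARD('n)"
      using card_mono[of UNIV "set q"] by simp
    then show ?thesis
      using q p assms
      by (intro exI[of _ q]) (auto simp: path_from_to_def walk_from_to_def walk_length_def)
  qed
  have real: "\<bar>walk_weight I p\<bar> \<noteq> \<infinity>" if "walk_from_to I i j p" for i j p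
    using that by (intro walk_weight_finite over_rmax_inf) (simp add: walk_from_to_def)
  show ?thesis
    unfolding w_inf_def v_inf_def
  proof (intro conjI SUP_finite_cases(2)[OF finite_bounded_walks])
    show "{p. walk_from_to I i c p \<and> walk_length p \<le> k} \<noteq> {}"
      "{p. walk_from_to I c j p \<and> walk_length p \<le> k} \<noteq> {}"
      using * by simp_all
  qed (auto dest: real)
qed

lemma closed_list_weight_le_0:
  assumes "p \<noteq> []" "hd p = last p"
  shows "walk_weight S p \<le> 0"
proof (cases "is_walk S p")
  case True
  show ?thesis
  proof (cases "butlast p = []")
    case True
    then obtain x where "p = [x]" using assms by (cases p rule: rev_cases) auto
    then show ?thesis by simp
  next
    case False
    then obtain r where r: "p = r @ [hd r]" "r \<noteq> []"
      using assms by (cases p rule: rev_cases) auto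
    then show ?thesis using closed_weight_le_0[of r] True by simp
  qed
next
  case False
  then show ?thesis using walk_weight_non_walk[OF over_rmax_sup] assms by simp
qed

lemma avoiding_cycle_weight_le:
  assumes "lambda_star X c \<le> ereal l" "ys \<noteq> []" "c \<notin> set ys" "is_walk S (ys @ [hd ys])"
  shows "walk_weight S (ys @ [hd ys]) \<le> ereal (l * real (length ys))"
proof -
  have "mean_weight S (ys @ [hd ys]) \<le> lambda_star X c"
    unfolding lambda_star_def by (rule SUP_upper) (use assms in auto)
  then have "walk_weight S (ys @ [hd ys]) / ereal (real (length ys)) \<le> ereal l"
    using assms(1) by (simp add: mean_weight_def walk_length_def)
  then show ?thesis
    using walk_sup_finite[OF assms(4)] assms(2)
    by (cases "walk_weight S (ys @ [hd ys])") (auto simp: divide_le_eq)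
qed

text \<open>
  A path that avoids \<open>c\<close> has at most \<open>n - 1\<close> nodes, so all nodes beyond that number have been
  cut out, each at the rate \<open>l\<close>.  The three bounds that follow extend this path by nothing, by a
  final step to \<open>c\<close> and by an initial step from \<open>c\<close>.
\<close>
lemma avoiding_walk_path:
  assumes l: "lambda_star X c \<le> ereal l" "l < 0"
    and p: "is_walk S p" "c \<notin> set p"
  obtains q where "path_from_to S (hd p) (last p) q" "c \<notin> set q"
    "walk_weight S p \<le> walk_weight S q + ereal (l * (real (length p) - real (CARD('n) - 1)))"
proof -
  have "set p \<subseteq> - {c}" using p by auto
  then obtain q where q: "path_from_to S (hd p) (last p) q" "set q \<subseteq> - {c}"
    "walk_weight S p \<le> walk_weight S q + ereal (l * (real (length p) - real (length q)))"
    using walk_excise_cycles[OF p(1), of "- {c}" l] avoiding_cycle_weight_le[OF l(1)] by blast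
  have "length q = card (set q)"
    using q(1) by (simp add: path_from_to_def distinct_card)
  also have "\<dots> \<le> card (- {c})"
    using q(2) by (intro card_mono) auto
  also have "\<dots> = CARD('n) - 1"
    by (simp add: Compl_eq_Diff_UNIV)
  finally have "real (length q) \<le> real (CARD('n) - 1)"
    by (rule of_nat_mono)
  then have "l * (real (length p) - real (length q)) \<le>
      l * (real (length p) - real (CARD('n) - 1))"
    using l(2) by (intro mult_left_mono_neg) linarith+
  then have "walk_weight S q + ereal (l * (real (length p) - real (length q))) \<le>
      walk_weight S q + ereal (l * (real (length p) - real (CARD('n) - 1)))"
    by (intro add_left_mono) simp
  then show ?thesis
    using q(1,2) order_trans[OF q(3)] by (intro that[of q]) auto
qed

lemma avoiding_walk_weight_le:
  assumes l: "lambda_star X c \<le> ereal l" "l < 0"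
    and p: "is_walk S p" "c \<notin> set p"
  shows "walk_weight S p \<le> gamma X c (hd p) (last p)
      + ereal (l * (real (length p) - real (CARD('n) - 1)))"
proof -
  obtain q where q: "path_from_to S (hd p) (last p) q" "c \<notin> set q"
    "walk_weight S p \<le> walk_weight S q + ereal (l * (real (length p) - real (CARD('n) - 1)))"
    using avoiding_walk_path[OF l p] .
  have g: "walk_weight S q \<le> gamma X c (hd p) (last p)"
    unfolding gamma_def by (rule SUP_upper) (use q in auto)
  show "walk_weight S p \<le> gamma X c (hd p) (last p)
      + ereal (l * (real (length p) - real (CARD('n) - 1)))"
    using order_trans[OF q(3) add_right_mono[OF g]] .
qed

lemma first_passage_weight_le:
  assumes l: "lambda_star X c \<le> ereal l" "l < 0"
    and p: "is_walk S (p @ [c])" "c \<notin> set p"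
  shows "walk_weight S (p @ [c]) \<le> alpha X c (hd (p @ [c]))
      + ereal (l * (real (length p) - real (CARD('n) - 1)))"
proof (cases "p = []")
  case True
  have "walk_weight S [c] \<le> alpha X c c"
    unfolding alpha_def by (rule SUP_upper) (simp add: path_from_to_def walk_from_to_def)
  moreover have "0 \<le> l * (0 - real (CARD('n) - 1))"
    using l(2) by (intro mult_nonpos_nonpos) auto
  ultimately have "0 + 0 \<le> alpha X c c + ereal (l * (0 - real (CARD('n) - 1)))"
    by (intro add_mono) simp_all
  then show ?thesis using True by simp
next
  case False
  then have step: "is_walk S p" "S $ last p $ c \<noteq> -\<infinity>"
    using p(1) by (auto simp: is_walk_snoc)
  obtain q where q: "path_from_to S (hd p) (last p) q" "c \<notin> set q"
    "walk_weight S p \<le> walk_weight S q + ereal (l * (real (length p) - real (CARD('n) - 1)))"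
    using avoiding_walk_path[OF l step(1) p(2)] .
  have q': "q \<noteq> []" "is_walk S q" "hd q = hd p" "last q = last p" "distinct q"
    using q(1) by (auto simp: path_from_to_def walk_from_to_def is_walk_def)
  have "walk_weight S (p @ [c]) = walk_weight S p + S $ last p $ c"
    using False by (rule walk_weight_snoc)
  also have "\<dots> \<le> walk_weight S q + ereal (l * (real (length p) - real (CARD('n) - 1)))
      + S $ last p $ c"
    by (intro add_right_mono q)
  also have "\<dots> = walk_weight S (q @ [c])
      + ereal (l * (real (length p) - real (CARD('n) - 1)))"
    using q' by (simp add: walk_weight_snoc ac_simps)
  also have "\<dots> \<le> alpha X c (hd (p @ [c])) + ereal (l * (real (length p) - real (CARD('n) - 1)))"
    unfolding alpha_def
    by (intro add_right_mono SUP_upper)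
      (use q q' step False in \<open>simp add: path_from_to_def walk_from_to_def is_walk_snoc\<close>)
  finally show ?thesis .
qed

lemma last_passage_weight_le:
  assumes l: "lambda_star X c \<le> ereal l" "l < 0"
    and p: "is_walk S (c # p)" "c \<notin> set p"
  shows "walk_weight S (c # p) \<le> beta X c (last (c # p))
      + ereal (l * (real (length p) - real (CARD('n) - 1)))"
proof (cases p)
  case Nil
  have "walk_weight S [c] \<le> beta X c c"
    unfolding beta_def by (rule SUP_upper) (simp add: path_from_to_def walk_from_to_def)
  moreover have "0 \<le> l * (0 - real (CARD('n) - 1))"
    using l(2) by (intro mult_nonpos_nonpos) auto
  ultimately have "0 + 0 \<le> beta X c c + ereal (l * (0 - real (CARD('n) - 1)))"
    by (intro add_mono) simp_all
  then show ?thesis using Nil by simp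
next
  case (Cons y ys)
  then have step: "is_walk S p" "S $ c $ y \<noteq> -\<infinity>"
    using p(1) by auto
  obtain q where q: "path_from_to S (hd p) (last p) q" "c \<notin> set q"
    "walk_weight S p \<le> walk_weight S q + ereal (l * (real (length p) - real (CARD('n) - 1)))"
    using avoiding_walk_path[OF l step(1) p(2)] .
  have "q \<noteq> []" "hd q = y"
    using q(1) Cons by (auto simp: path_from_to_def walk_from_to_def is_walk_def)
  then obtain r where r: "q = y # r" by (cases q) auto
  have "walk_weight S (c # p) = S $ c $ y + walk_weight S p"
    using Cons by simp
  also have "\<dots> \<le> S $ c $ y + (walk_weight S q
      + ereal (l * (real (length p) - real (CARD('n) - 1))))"
    by (intro add_left_mono q)
  also have "\<dots> = walk_weight S (c # q)
      + ereal (l * (real (length p) - real (CARD('n) - 1)))"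
    using r by (simp add: ac_simps)
  also have "\<dots> \<le> beta X c (last (c # p)) + ereal (l * (real (length p) - real (CARD('n) - 1)))"
    unfolding beta_def
    by (intro add_right_mono SUP_upper)
      (use q r step Cons in \<open>auto simp: path_from_to_def walk_from_to_def\<close>)
  finally show ?thesis .
qed

end

section \<open>Products of matrices from the set\<close>

locale standing_product = standing X c for X :: "(ereal ^ 'n ^ 'n) set" and c :: 'n +
  fixes A :: "nat \<Rightarrow> ereal ^ 'n ^ 'n" and k :: nat
  assumes mem: "t \<in> {1..k} \<Longrightarrow> A t \<in> X"
begin

abbreviation "\<Gamma> \<equiv> mp_prod A k"

lemma factor_over_rmax: "t \<in> {1..k} \<Longrightarrow> over_rmax (A t)"
  using mem over_rmax_mem by blast

lemma product_attained:
  assumes "\<Gamma> $ i $ j \<noteq> -\<infinity>"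
  obtains p where "p 0 = i" "p k = j" "\<Gamma> $ i $ j = seg_weight A p 0 k"
  using mp_prod_attained[OF assms factor_over_rmax] .

lemma seg_weight_le_sup:
  assumes "s \<le> t" "t \<le> k"
  shows "seg_weight A p s t \<le> walk_weight S (map p [s..<Suc t])"
proof -
  have "seg_weight A p s t \<le> seg_weight (\<lambda>_. S) p s t"
    using assms by (intro seg_weight_mono le_sup mem) auto
  then show ?thesis using seg_weight_const[OF assms(1), of S p] by simp
qed

lemma inf_le_seg_weight:
  assumes "s \<le> t" "t \<le> k"
  shows "walk_weight I (map p [s..<Suc t]) \<le> seg_weight A p s t"
proof -
  have "seg_weight (\<lambda>_. I) p s t \<le> seg_weight A p s t"
    using assms by (intro seg_weight_mono inf_le mem) auto
  then show ?thesis using seg_weight_const[OF assms(1), of I p] by simp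
qed

lemma sup_walk:
  assumes "s \<le> t" "t \<le> k" "seg_weight A p s t \<noteq> -\<infinity>"
  shows "is_walk S (map p [s..<Suc t])"
proof (rule ccontr)
  assume "\<not> ?thesis"
  then have "walk_weight S (map p [s..<Suc t]) = -\<infinity>"
    using assms(1) by (intro walk_weight_non_walk over_rmax_sup) auto
  then show False using seg_weight_le_sup[OF assms(1,2), of p] assms(3) by simp
qed

lemma closed_seg_weight_le_0:
  assumes "s \<le> t" "t \<le> k" "p s = p t"
  shows "seg_weight A p s t \<le> 0"
proof -
  have "hd (map p [s..<Suc t]) = p s" "last (map p [s..<Suc t]) = p t"
    using assms(1) by (simp_all add: hd_map last_map del: upt_Suc)
  then have "walk_weight S (map p [s..<Suc t]) \<le> 0"
    using assms by (intro closed_list_weight_le_0) auto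
  then show ?thesis using seg_weight_le_sup[OF assms(1,2), of p] by (rule order_trans[rotated])
qed

lemma seg_weight_loop:
  assumes "t \<le> k" "\<And>u. s \<le> u \<Longrightarrow> u \<le> t \<Longrightarrow> p u = c"
  shows "seg_weight A p s t = 0"
proof (rule seg_weight_stay)
  show "p u = c" if "s \<le> u" "u \<le> t" for u using assms that by blast
  show "A (Suc u) $ c $ c = 0" if "s \<le> u" "u < t" for u
    using assms(1) that by (intro loop_mem mem) auto
qed

text \<open>
  After its arrival at \<open>c\<close> the walk waits there until time \<open>k\<close>.
\<close>
lemma arrival_weight_le:
  assumes "p s = c" "s \<le> k"
  shows "seg_weight A p 0 s \<le> \<Gamma> $ p 0 $ c"
proof -
  let ?r = "\<lambda>u. if u \<le> s then p u else c"
  have "seg_weight A ?r 0 k = seg_weight A ?r 0 s + seg_weight A ?r s k"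
    using assms by (intro seg_weight_split) auto
  also have "seg_weight A ?r 0 s = seg_weight A p 0 s"
    by (rule seg_weight_cong) simp
  also have "seg_weight A ?r s k = 0"
    using assms by (intro seg_weight_loop) auto
  finally show ?thesis
    using seg_weight_le_mp_prod[of ?r "p 0" k c A] assms by auto
qed

text \<open>
  Before its departure from \<open>c\<close> the walk waits there from time 0 on.
\<close>
lemma departure_weight_le:
  assumes "p s = c" "s \<le> k"
  shows "seg_weight A p s k \<le> \<Gamma> $ c $ p k"
proof -
  let ?r = "\<lambda>u. if u < s then c else p u"
  have "seg_weight A ?r 0 k = seg_weight A ?r 0 s + seg_weight A ?r s k"
    using assms by (intro seg_weight_split) auto
  also have "seg_weight A ?r 0 s = 0"
    using assms by (intro seg_weight_loop) auto
  also have "seg_weight A ?r s k = seg_weight A p s k"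
    by (rule seg_weight_cong) simp
  finally show ?thesis
    using seg_weight_le_mp_prod[of ?r c k "p k" A] assms by auto
qed

text \<open>
  A walk on the digraph of the infimum loses no weight when its steps are charged by actual factors,
  whatever their times.  It is run at the start of the product if it ends at \<open>c\<close>, and at the end of
  the product if it begins at \<open>c\<close>; the remaining time is spent waiting.
\<close>
lemma w_inf_le: "w_inf X c k i \<le> \<Gamma> $ i $ c"
  unfolding w_inf_def
proof (rule SUP_least, clarify)
  fix q assume q: "walk_from_to I i c q" and len: "walk_length q \<le> k"
  define s where "s = walk_length q"
  have q_ne: "q \<noteq> []" and ends: "hd q = i" "last q = c"
    using q by (auto simp: walk_from_to_def is_walk_def)
  have "length q = Suc s" using q_ne by (simp add: s_def walk_length_def)
  then have "map (nth q) [0..<Suc s] = q" "q ! 0 = i" "q ! s = c"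
    using ends q_ne map_nth[of q] by (simp_all add: hd_conv_nth last_conv_nth)
  then show "walk_weight I q \<le> \<Gamma> $ i $ c"
    using inf_le_seg_weight[of 0 s "nth q"] arrival_weight_le[of "nth q" s] len
    by (auto simp: s_def intro: order_trans)
qed

lemma v_inf_le: "v_inf X c k j \<le> \<Gamma> $ c $ j"
  unfolding v_inf_def
proof (rule SUP_least, clarify)
  fix q assume q: "walk_from_to I c j q" and len: "walk_length q \<le> k"
  define s where "s = k - walk_length q"
  define p where "p = (\<lambda>u. q ! (u - s))"
  have q_ne: "q \<noteq> []" and ends: "hd q = c" "last q = j"
    using q by (auto simp: walk_from_to_def is_walk_def)
  have l: "length q = Suc (k - s)" "s \<le> k"
    using q_ne len by (auto simp: s_def walk_length_def)
  then have "map p [s..<Suc k] = q"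
    by (intro nth_equalityI) (auto simp: p_def nth_append simp del: upt_Suc)
  moreover have "p s = c" "p k = j"
    using ends q_ne l by (simp_all add: p_def hd_conv_nth last_conv_nth)
  ultimately show "walk_weight I q \<le> \<Gamma> $ c $ j"
    using inf_le_seg_weight[of s k p] departure_weight_le[of p s] l
    by (auto intro: order_trans)
qed

text \<open>
  The walk is an optimal one and \<open>s\<close> its first visit to \<open>c\<close>: what follows is a closed walk and so
  contributes at most 0, and what precedes avoids \<open>c\<close>, which limits its weight in terms of \<open>s\<close>.
\<close>
lemma early_arrival:
  assumes l: "lambda_star X c \<le> ereal l" "l < 0" and fin: "\<Gamma> $ i $ c \<noteq> -\<infinity>"
  obtains p s where "p 0 = i" "p s = c" "s \<le> k" "\<Gamma> $ i $ c \<le> seg_weight A p 0 s"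
    "\<Gamma> $ i $ c \<le> alpha X c i + ereal (l * (real s - real (CARD('n) - 1)))"
proof -
  obtain p where p: "p 0 = i" "p k = c" "\<Gamma> $ i $ c = seg_weight A p 0 k"
    using product_attained[OF fin] .
  define s where "s = (LEAST u. p u = c)"
  have s: "p s = c" "s \<le> k" "\<And>u. u < s \<Longrightarrow> p u \<noteq> c"
    unfolding s_def using p(2) by (auto intro: LeastI Least_le dest: not_less_Least)
  have "\<Gamma> $ i $ c = seg_weight A p 0 s + seg_weight A p s k"
    using p(3) seg_weight_split[of 0 s k A p] s by simp
  also have "\<dots> \<le> seg_weight A p 0 s + 0"
    using s p by (intro add_left_mono closed_seg_weight_le_0) auto
  finally have le: "\<Gamma> $ i $ c \<le> seg_weight A p 0 s" by simp
  then have "seg_weight A p 0 s \<noteq> -\<infinity>" using fin by auto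
  then have walk: "is_walk S (map p [0..<Suc s])" using s by (intro sup_walk) auto
  let ?P = "map p [0..<s]"
  have snoc: "map p [0..<Suc s] = ?P @ [c]" using s by simp
  have hd: "hd (?P @ [c]) = i"
    using p(1) s(1) by (cases s) (auto simp: upt_conv_Cons simp del: upt_Suc)
  have "c \<notin> set ?P" using s(3) by fastforce
  then have "walk_weight S (?P @ [c])
      \<le> alpha X c i + ereal (l * (real s - real (CARD('n) - 1)))"
    using first_passage_weight_le[OF l walk[unfolded snoc]] hd by simp
  then have "\<Gamma> $ i $ c \<le> alpha X c i + ereal (l * (real s - real (CARD('n) - 1)))"
    using le seg_weight_le_sup[of 0 s p] s unfolding snoc by (meson order_trans zero_le)
  then show ?thesis using that p(1) s(1,2) le by blast
qed

text \<open>
  The mirror image of \<open>early_arrival\<close>, with the last visit to \<open>c\<close>.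
\<close>
lemma late_departure:
  assumes l: "lambda_star X c \<le> ereal l" "l < 0" and fin: "\<Gamma> $ c $ j \<noteq> -\<infinity>"
  obtains p s where "p k = j" "p s = c" "s \<le> k" "\<Gamma> $ c $ j \<le> seg_weight A p s k"
    "\<Gamma> $ c $ j \<le> beta X c j + ereal (l * (real k - real s - real (CARD('n) - 1)))"
proof -
  obtain p where p: "p 0 = c" "p k = j" "\<Gamma> $ c $ j = seg_weight A p 0 k"
    using product_attained[OF fin] .
  define s where "s = (GREATEST u. p u = c \<and> u \<le> k)"
  have "p s = c \<and> s \<le> k"
    unfolding s_def by (rule GreatestI_nat[where b = k and k = 0]) (use p in auto)
  moreover have "p u \<noteq> c" if "s < u" "u \<le> k" for u
    using Greatest_le_nat[of "\<lambda>u. p u = c \<and> u \<le> k" u k] that unfolding s_def by auto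
  ultimately have s: "p s = c" "s \<le> k" "\<And>u. s < u \<Longrightarrow> u \<le> k \<Longrightarrow> p u \<noteq> c" by auto
  have "\<Gamma> $ c $ j = seg_weight A p 0 s + seg_weight A p s k"
    using p(3) seg_weight_split[of 0 s k A p] s by simp
  also have "\<dots> \<le> 0 + seg_weight A p s k"
    using s p by (intro add_right_mono closed_seg_weight_le_0) auto
  finally have le: "\<Gamma> $ c $ j \<le> seg_weight A p s k" by simp
  then have "seg_weight A p s k \<noteq> -\<infinity>" using fin by auto
  then have walk: "is_walk S (map p [s..<Suc k])" using s by (intro sup_walk) auto
  let ?P = "map p [Suc s..<Suc k]"
  have cons: "map p [s..<Suc k] = c # ?P" using s by (simp add: upt_conv_Cons del: upt_Suc)
  have last: "last (c # ?P) = j"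
    using p(2) s(1,2) by (cases "s = k") (auto simp: last_map)
  have "c \<notin> set ?P" using s(3) by (fastforce simp: less_Suc_eq_le Suc_le_eq simp del: upt_Suc)
  then have "walk_weight S (c # ?P)
      \<le> beta X c j + ereal (l * (real k - real s - real (CARD('n) - 1)))"
    using last_passage_weight_le[OF l walk[unfolded cons]] last s(2)
    by (simp add: of_nat_diff del: upt_Suc)
  then have "\<Gamma> $ c $ j \<le> beta X c j + ereal (l * (real k - real s - real (CARD('n) - 1)))"
    using le seg_weight_le_sup[of s k p] s unfolding cons by (meson order_trans order_refl)
  then show ?thesis using that p(2) s(1,2) le by blast
qed

lemma product_entry_le:
  assumes l: "lambda_star X c \<le> ereal l" "l < 0"
    and g: "gamma X c i j + ereal (l * (real k - real (CARD('n) - 1)))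
      \<le> w_inf X c k i + v_inf X c k j"
  shows "\<Gamma> $ i $ j \<le> \<Gamma> $ i $ c + \<Gamma> $ c $ j"
proof (cases "\<Gamma> $ i $ j = -\<infinity>")
  case False
  obtain p where p: "p 0 = i" "p k = j" "\<Gamma> $ i $ j = seg_weight A p 0 k"
    using product_attained[OF False] .
  show ?thesis
  proof (cases "\<exists>s\<le>k. p s = c")
    case True
    then obtain s where s: "s \<le> k" "p s = c" by blast
    then have "\<Gamma> $ i $ j = seg_weight A p 0 s + seg_weight A p s k"
      using p(3) seg_weight_split[of 0 s k A p] by simp
    also have "\<dots> \<le> \<Gamma> $ i $ c + \<Gamma> $ c $ j"
      using arrival_weight_le[of p s] departure_weight_le[of p s] s p by (intro add_mono) auto
    finally show ?thesis .
  next
    case no_c: False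
    let ?P = "map p [0..<Suc k]"
    have walk: "is_walk S ?P" using p(3) False by (intro sup_walk) auto
    have "c \<notin> set ?P" using no_c by (auto simp: less_Suc_eq_le simp del: upt_Suc)
    have ends: "hd ?P = i" "last ?P = j"
      using p by (simp_all add: hd_map last_map del: upt_Suc)
    have "\<Gamma> $ i $ j \<le> walk_weight S ?P"
      using p(3) seg_weight_le_sup[of 0 k p] by simp
    also have "\<dots> \<le> gamma X c i j + ereal (l * (real (Suc k) - real (CARD('n) - 1)))"
      using avoiding_walk_weight_le[OF l walk \<open>c \<notin> set ?P\<close>] ends by (simp del: upt_Suc)
    \<comment> \<open>The list has one node more than the walk has steps; \<open>l < 0\<close> absorbs the difference.\<close>
    also have "\<dots> \<le> gamma X c i j + ereal (l * (real k - real (CARD('n) - 1)))"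
      using l(2) by (intro add_left_mono) (auto intro: mult_left_mono_neg)
    also note g
    also have "w_inf X c k i + v_inf X c k j \<le> \<Gamma> $ i $ c + \<Gamma> $ c $ j"
      by (intro add_mono w_inf_le v_inf_le)
    finally show ?thesis .
  qed
qed simp

lemma product_entry_ge:
  assumes l: "lambda_star X c \<le> ereal l" "l < 0"
    and wv: "\<bar>w_inf X c k i\<bar> \<noteq> \<infinity>" "\<bar>v_inf X c k j\<bar> \<noteq> \<infinity>"
    and ab: "alpha X c i + beta X c j + ereal (l * (real k - 2 * real (CARD('n) - 1)))
      < w_inf X c k i + v_inf X c k j"
  shows "\<Gamma> $ i $ c + \<Gamma> $ c $ j \<le> \<Gamma> $ i $ j"
proof -
  let ?m = "real (CARD('n) - 1)"
  have fin: "\<Gamma> $ i $ c \<noteq> -\<infinity>" "\<Gamma> $ c $ j \<noteq> -\<infinity>"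
    using w_inf_le[of i] v_inf_le[of j] wv by auto
  obtain p s where p: "p 0 = i" "p s = c" "s \<le> k" "\<Gamma> $ i $ c \<le> seg_weight A p 0 s"
    "\<Gamma> $ i $ c \<le> alpha X c i + ereal (l * (real s - ?m))"
    using early_arrival[OF l fin(1)] .
  obtain q t where q: "q k = j" "q t = c" "t \<le> k" "\<Gamma> $ c $ j \<le> seg_weight A q t k"
    "\<Gamma> $ c $ j \<le> beta X c j + ereal (l * (real k - real t - ?m))"
    using late_departure[OF l fin(2)] .
  \<comment> \<open>Otherwise the two parts take at least \<open>k\<close> steps in total and are too light together.\<close>
  have "s < t"
  proof (rule ccontr)
    assume "\<not> s < t"
    then have "l * (real s + (real k - real t) - 2 * ?m) \<le> l * (real k - 2 * ?m)"
      using l(2) by (intro mult_left_mono_neg) auto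
    moreover obtain w v a b where "w_inf X c k i = ereal w" "v_inf X c k j = ereal v"
        "alpha X c i = ereal a" "beta X c j = ereal b"
      using wv finite_alpha[of i] finite_beta[of j] by fastforce
    moreover have "w_inf X c k i \<le> alpha X c i + ereal (l * (real s - ?m))"
      using order_trans[OF w_inf_le p(5)] .
    moreover have "v_inf X c k j \<le> beta X c j + ereal (l * (real k - real t - ?m))"
      using order_trans[OF v_inf_le q(5)] .
    ultimately show False
      using ab by (simp add: algebra_simps)
  qed
  let ?r = "\<lambda>u. if u \<le> s then p u else if u < t then c else q u"
  have "\<Gamma> $ i $ c + \<Gamma> $ c $ j \<le> seg_weight A p 0 s + seg_weight A q t k"
    by (intro add_mono p q)
  also have "seg_weight A p 0 s = seg_weight A ?r 0 s"
    by (rule seg_weight_cong) simp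
  also have "seg_weight A q t k = seg_weight A ?r t k"
    using \<open>s < t\<close> by (intro seg_weight_cong) simp
  also have "seg_weight A ?r 0 s + seg_weight A ?r t k = seg_weight A ?r 0 k"
  proof -
    have "seg_weight A ?r s t = 0"
      using p q by (intro seg_weight_loop) auto
    then show ?thesis
      using \<open>s < t\<close> q(3) seg_weight_split[of 0 s k A ?r] seg_weight_split[of s t k A ?r] by simp
  qed
  also have "\<dots> \<le> \<Gamma> $ i $ j"
    using p q \<open>s < t\<close> by (intro seg_weight_le_mp_prod) auto
  finally show ?thesis .
qed

lemma product_entry_factors:
  assumes g: "gamma_quot X c k i j + ereal (real CARD('n) - 1) < ereal (real k)"
    and ab: "alpha_beta_quot X c k i j + ereal (2 * (real CARD('n) - 1)) < ereal (real k)"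
  shows "\<Gamma> $ i $ j = \<Gamma> $ i $ c + \<Gamma> $ c $ j"
proof -
  have m: "real CARD('n) - 1 = real (CARD('n) - 1)"
    by (simp add: of_nat_diff Suc_leI)
  have reach: "w_inf X c k i \<noteq> -\<infinity> \<and> v_inf X c k j \<noteq> -\<infinity>" if "CARD('n) - 1 \<le> k"
    using that by (intro wv_ne_minf) simp
  obtain l where "l < 0" "lambda_star X c \<le> ereal l" "\<bar>w_inf X c k i\<bar> \<noteq> \<infinity>" "\<bar>v_inf X c k j\<bar> \<noteq> \<infinity>"
    "gamma X c i j + ereal (l * (real k - real (CARD('n) - 1))) < w_inf X c k i + v_inf X c k j"
    "alpha X c i + beta X c j + ereal (l * (real k - 2 * real (CARD('n) - 1)))
      < w_inf X c k i + v_inf X c k j"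
    using threshold_rate[OF lambda_star_neg w_ne_pinf v_ne_pinf gamma_ne_pinf finite_alpha
        finite_beta reach g[unfolded gamma_quot_def m] ab[unfolded alpha_beta_quot_def m]] .
  then show ?thesis
    using product_entry_le[of l i j] product_entry_ge[of l i j] by (intro antisym) auto
qed

end

theorem corollary4p4:
  fixes X :: "(ereal ^ 'n ^ 'n) set" and c :: 'n
    and A :: "nat \<Rightarrow> ereal ^ 'n ^ 'n" and k :: nat
  assumes "standing_assumptions X c"
    and "\<And>t. t \<in> {1..k} \<Longrightarrow> A t \<in> X"
    and "ereal (real k) >
      (MAX i. MAX j. max
        (gamma_quot X c k i j + ereal (real CARD('n) - 1))
        (alpha_beta_quot X c k i j + ereal (2 * (real CARD('n) - 1))))"
  shows "rank_one (mp_prod A k) \<and>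
    mp_prod A k = mp_outer (\<chi> i. mp_prod A k $ i $ c) (\<chi> j. mp_prod A k $ c $ j)"
proof -
  interpret standing_product X c A k
    using assms(1,2) by unfold_locales
  have "\<Gamma> $ i $ j = \<Gamma> $ i $ c + \<Gamma> $ c $ j" for i j
    using assms(3) by (intro product_entry_factors) simp_all
  then have eq: "\<Gamma> = mp_outer (\<chi> i. \<Gamma> $ i $ c) (\<chi> j. \<Gamma> $ c $ j)"
    unfolding mp_outer_def vec_eq_iff vec_lambda_beta by blast
  moreover have "\<Gamma> $ i $ j \<noteq> \<infinity>" for i j
    using factor_over_rmax by (rule mp_prod_ne_pinf)
  ultimately have "rank_one \<Gamma>"
    unfolding rank_one_def
    by (intro exI[of _ "\<chi> i. \<Gamma> $ i $ c"] exI[of _ "\<chi> j. \<Gamma> $ c $ j"]) simp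
  with eq show ?thesis by blast
qed

end
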